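(* Let $d$ be a positive integer. For every integer $h$ with $2\le h\le d^{2}$, it is possible to mask all the (pure) states of the $h$-level system $\mathbb{C}^{h}$ into a 4-qudit system $\mathbb{C}^{d}\otimes\mathbb{C}^{d}\otimes\mathbb{C}^{d}\otimes\mathbb{C}^{d}$; i.e., there exists a universal masker $\mathbb{C}^{h}\to\mathbb{C}^{d}\otimes\mathbb{C}^{d}\otimes\mathbb{C}^{d}\otimes\mathbb{C}^{d}$.
   Context: A pure state of a finite-dimensional complex Hilbert space $H$ is a unit vector of $H$. A $k$-level system is $\mathbb{C}^{k}$ with its standard inner product; an $N$-qudit system with local dimension $d$ is $(\mathbb{C}^{d})^{\otimes N}$, with tensor factors (local systems) labelled $A_1,\dots,A_N$. Multipartite masker: an operation $S$ masks the quantum information encoded in a set of pure states $\{|\psi_i\rangle\}\subset\mathbb{C}^{k}$ into a set of multipartite pure states $\{|\Psi_i\rangle\}\subset(\mathbb{C}^{d})^{\otimes N}$ if $S$ sends $|\psi_i\rangle$ to $|\Psi_i\rangle$ and all the reductions to each local system are identical: for every $l\in\{1,\dots,N\}$, the reduced density matrix $\rho_{A_l}=\mathrm{Tr}_{A_l^{c}}|\Psi_i\rangle\langle\Psi_i|$ does not depend on $i$, where $A_l^{c}=\{A_1,\dots,A_N\}\setminus\{A_l\}$ and $\mathrm{Tr}_{A_l^{c}}$ is the partial trace over all tensor factors other than the $l$-th. Masking operations are physically implemented by a unitary (after adjoining ancillary systems), i.e. they are given by a linear isometry $S:\mathbb{C}^{k}\to(\mathbb{C}^{d})^{\otimes N}$.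 A universal masker $\mathbb{C}^{k}\to(\mathbb{C}^{d})^{\otimes N}$ is a masker that masks the set of all pure states of $\mathbb{C}^{k}$: for every $l$, $\mathrm{Tr}_{A_l^{c}}\big(S|\psi\rangle\langle\psi|S^{\dagger}\big)$ is the same for all unit vectors $|\psi\rangle\in\mathbb{C}^{k}$. *)

theory Defs
  imports "HOL-Analysis.Analysis"
begin

text \<open>
  The \<open>k\<close>-level system is \<open>complex ^ 'k\<close> with \<open>k = CARD('k)\<close>.  The \<open>N\<close>-qudit system with
  local dimension \<open>d\<close>, where \<open>N = CARD('n)\<close> and \<open>d = CARD('d)\<close>, is \<open>complex ^ ('n \<Rightarrow> 'd)\<close>:
  the coordinate at \<open>f :: 'n \<Rightarrow> 'd\<close> is the coefficient of the product basis vector whose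
  tensor factor at \<open>l\<close> is the standard basis vector with index \<open>f l\<close>.  The norm on these types is
  the one induced by the standard Hermitian inner product.
\<close>

definition pure_states :: "(complex ^ 'k::finite) set" where
  "pure_states = {\<psi>. norm \<psi> = 1}"

text \<open>The rank-one operator \<open>|\<psi>\<rangle>\<langle>\<psi>|\<close>, as a matrix in the standard basis.\<close>

definition density :: "complex ^ 'k::finite \<Rightarrow> complex ^ 'k ^ 'k" where
  "density \<psi> = (\<chi> i j. \<psi> $ i * cnj (\<psi> $ j))"

text \<open>
  The partial trace over all tensor factors other than \<open>l\<close>.  The summation index \<open>c\<close> runs over the
  product basis of these other factors; its value at \<open>l\<close> is irrelevant, being overwritten by
  the row or column index of the result.
\<close>

definition reduction ::
  "'n::finite \<Rightarrow> complex ^ ('n \<Rightarrow> 'd::finite) ^ ('n \<Rightarrow> 'd) \<Rightarrow> complex ^ 'd ^ 'd" where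
  "reduction l \<rho> = (\<chi> a b. \<Sum>c \<in> (UNIV - {l}) \<rightarrow>\<^sub>E UNIV. \<rho> $ (c(l := a)) $ (c(l := b)))"

definition linear_isometry :: "(complex ^ 'k::finite \<Rightarrow> complex ^ 'm::finite) \<Rightarrow> bool" where
  "linear_isometry S \<longleftrightarrow>
     Vector_Spaces.linear (*s) (*s) S \<and> (\<forall>x. norm (S x) = norm x)"

definition masks ::
  "(complex ^ 'k::finite \<Rightarrow> complex ^ ('n::finite \<Rightarrow> 'd::finite)) \<Rightarrow> (complex ^ 'k) set \<Rightarrow> bool"
  where
  "masks S \<Psi> \<longleftrightarrow>
     linear_isometry S \<and>
     (\<forall>l. \<forall>\<psi>\<in>\<Psi>. \<forall>\<phi>\<in>\<Psi>. reduction l (density (S \<psi>)) = reduction l (density (S \<phi>)))"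

definition universal_masker ::
  "(complex ^ 'k::finite \<Rightarrow> complex ^ ('n::finite \<Rightarrow> 'd::finite)) \<Rightarrow> bool" where
  "universal_masker S \<longleftrightarrow> masks S pure_states"

end

theory Submission imports Defs begin

text \<open>
  Identify the local basis with \<open>\<int>/d\<close> and send the basis vector \<open>|x,y\<rangle>\<close> of \<open>\<complex>\<^sup>d \<otimes> \<complex>\<^sup>d\<close> to
  \<open>d\<^sup>-\<^sup>1\<^sup>/\<^sup>2 \<Sum>\<^sub>j |j, j+x, j+y, j+x+y\<rangle>\<close>, restricting to \<open>h\<close> of the \<open>d\<^sup>2\<close> pairs \<open>(x,y)\<close>.  The product
  vectors that occur are those \<open>|a,b,c,e\<rangle>\<close> with \<open>a + e = b + c\<close>, so any three entries determine the
  fourth, and every single-system reduction is diagonal.  For each \<open>(x,y)\<close> every local system takes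
  each value for exactly one \<open>j\<close>, so the diagonal entries all equal \<open>1/d\<close>, whatever the state.
\<close>

text \<open>Column \<open>k\<close> is the uniform superposition of the words \<open>w k j\<close>.
  The factor is a normalisation once these \<open>d\<close> words are distinct.\<close>

definition code_matrix ::
  "('k \<Rightarrow> 'd \<Rightarrow> 'n \<Rightarrow> 'd) \<Rightarrow> complex ^ 'k::finite ^ ('n::finite \<Rightarrow> 'd::finite)" where
  "code_matrix w = (\<chi> f k. of_bool (f \<in> range (w k)) / of_real (sqrt CARD('d)))"

text \<open>Any two words, from the same \<open>k\<close> or not, differ in at least two places:
  this kills the off-diagonal entries of each reduction. Bijectivity in each coordinate makes the
  diagonal uniform.\<close>

locale detecting_code =
  fixes w :: "'k::finite \<Rightarrow> 'd::finite \<Rightarrow> 'n::finite \<Rightarrow> 'd"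
  assumes separated: "\<And>l k j k' j'. (\<And>i. i \<noteq> l \<Longrightarrow> w k j i = w k' j' i) \<Longrightarrow> k = k' \<and> j = j'"
    and bij_coordinate: "\<And>k l. bij (\<lambda>j. w k j l)"
begin

lemma word_eq_iff [simp]: "w k j = w k' j' \<longleftrightarrow> k = k' \<and> j = j'"
  \<comment> \<open>Equal words agree off any coordinate, so an arbitrary one will do.\<close>
  using separated[of undefined k j k' j'] by auto

lemma word_in_range_iff [simp]: "w k j \<in> range (w k') \<longleftrightarrow> k' = k"
  by (auto simp: image_iff)

lemma code_matrix_word:
  "(code_matrix w *v \<psi>) $ w k j = \<psi> $ k / of_real (sqrt CARD('d))"
proof -
  have "(code_matrix w *v \<psi>) $ w k j
      = (\<Sum>k'\<in>UNIV. if k' = k then \<psi> $ k / of_real (sqrt CARD('d)) else 0)"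
    unfolding code_matrix_def matrix_vector_mult_def vec_lambda_beta
    by (rule sum.cong) simp_all
  then show ?thesis by simp
qed

lemma code_matrix_nonword:
  assumes "\<And>k j. f \<noteq> w k j"
  shows "(code_matrix w *v \<psi>) $ f = 0"
proof -
  have "f \<notin> range (w k)" for k
    using assms by blast
  then show ?thesis
    by (simp add: code_matrix_def matrix_vector_mult_def)
qed

lemma norm_code_matrix_word:
  "(norm ((code_matrix w *v \<psi>) $ w k j))\<^sup>2 = (norm (\<psi> $ k))\<^sup>2 / CARD('d)"
  by (simp add: code_matrix_word norm_divide power_divide)

text \<open>Distinct words do not interfere: each \<open>k\<close> contributes \<open>d\<close>
  entries of squared modulus |\<psi>_k|^2 / d.\<close>

lemma norm_code_matrix: "norm (code_matrix w *v \<psi>) = norm \<psi>"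
proof -
  let ?g = "\<lambda>f. (norm ((code_matrix w *v \<psi>) $ f))\<^sup>2"
  have inj: "inj (\<lambda>(k, j). w k j)"
    by (auto simp: inj_on_def)
  have "(\<Sum>f\<in>UNIV. ?g f) = (\<Sum>f\<in>range (\<lambda>(k, j). w k j). ?g f)"
    by (rule sum.mono_neutral_right) (auto intro!: code_matrix_nonword)
  also have "\<dots> = (\<Sum>(k, j)\<in>UNIV \<times> UNIV. ?g (w k j))"
    by (subst sum.reindex[OF inj]) (simp only: o_def case_prod_unfold UNIV_Times_UNIV)
  also have "\<dots> = (\<Sum>k\<in>UNIV. \<Sum>j\<in>UNIV. ?g (w k j))"
    by (simp only: sum.cartesian_product)
  also have "\<dots> = (\<Sum>k\<in>UNIV. (norm (\<psi> $ k))\<^sup>2)"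
    by (simp add: norm_code_matrix_word)
  finally show ?thesis
    by (simp add: norm_vec_def L2_set_def)
qed

text \<open>For a unit vector this is the maximally mixed state, whatever the vector.\<close>

lemma reduction_code_matrix:
  "reduction l (density (code_matrix w *v \<psi>)) = mat (of_real ((norm \<psi>)\<^sup>2 / CARD('d)))"
proof -
  let ?S = "code_matrix w *v \<psi>"
  \<comment> \<open>Both factors nonzero would give two words that differ only at
    \<open>l\<close>.\<close>
  have offdiag: "?S $ c(l := a) * cnj (?S $ c(l := b)) = 0" if "a \<noteq> b" for a b c
  proof (rule ccontr)
    assume nz: "\<not> ?thesis"
    obtain k j where 1: "c(l := a) = w k j"
      using nz code_matrix_nonword[of "c(l := a)" \<psi>] by fastforce
    obtain k' j' where 2: "c(l := b) = w k' j'"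
      using nz code_matrix_nonword[of "c(l := b)" \<psi>] by fastforce
    have "k = k' \<and> j = j'"
      by (rule separated[of l]) (simp flip: 1 2)
    then have "c(l := a) = c(l := b)"
      using 1 2 by simp
    then show False
      using that by (metis fun_upd_same)
  qed
  have diag: "(\<Sum>c\<in>(UNIV - {l}) \<rightarrow>\<^sub>E UNIV. ?S $ c(l := a) * cnj (?S $ c(l := a)))
      = of_real ((norm \<psi>)\<^sup>2 / CARD('d))" (is "?lhs = _") for a
  proof -
    \<comment> \<open>For each \<open>k\<close> exactly one word has the value \<open>a\<close> at
      \<open>l\<close>; \<open>J k\<close> is its index.\<close>
    define J where "J k = inv (\<lambda>j. w k j l) a" for k
    have J: "w k j l = a \<longleftrightarrow> j = J k" for k j
      unfolding J_def
      by (metis bij_coordinate bij_inv_eq_iff)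
    have "?lhs = (\<Sum>c\<in>(UNIV - {l}) \<rightarrow>\<^sub>E UNIV. of_real ((norm (?S $ c(l := a)))\<^sup>2))"
      by (simp only: complex_norm_square)
    also have "\<dots> = (\<Sum>f | f l = a. of_real ((norm (?S $ f))\<^sup>2))"
      \<comment> \<open>Extensional functions are \<open>undefined\<close> outside their domain, so
        the inverse map resets the value at \<open>l\<close> to that.\<close>
      by (rule sum.reindex_bij_witness[where i = "\<lambda>f. f(l := undefined)" and j = "\<lambda>c. c(l := a)"])
        (auto simp: PiE_def extensional_def)
    also have "\<dots> = (\<Sum>f\<in>range (\<lambda>k. w k (J k)). of_real ((norm (?S $ f))\<^sup>2))"
    proof (rule sum.mono_neutral_right)
      show "range (\<lambda>k. w k (J k)) \<subseteq> {f. f l = a}"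
        using J by auto
      show "\<forall>f\<in>{f. f l = a} - range (\<lambda>k. w k (J k)). of_real ((norm (?S $ f))\<^sup>2) = (0 :: complex)"
      proof
        fix f assume f: "f \<in> {f. f l = a} - range (\<lambda>k. w k (J k))"
        have "f \<noteq> w k j" for k j
        proof
          assume "f = w k j"
          moreover from this have "j = J k"
            using f J by blast
          ultimately show False
            using f by blast
        qed
        then show "of_real ((norm (?S $ f))\<^sup>2) = (0 :: complex)"
          by (simp add: code_matrix_nonword)
      qed
    qed simp
    also have "\<dots> = (\<Sum>k\<in>UNIV. of_real ((norm (\<psi> $ k))\<^sup>2 / CARD('d)))"
      by (subst sum.reindex) (auto simp only: inj_on_def word_eq_iff o_def norm_code_matrix_word)
    also have "\<dots> = of_real ((norm \<psi>)\<^sup>2 / CARD('d))"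
      by (simp add: norm_vec_def L2_set_def sum_nonneg sum_divide_distrib)
    finally show ?thesis .
  qed
  show ?thesis
    unfolding vec_eq_iff
  proof (intro allI)
    fix a b
    show "reduction l (density ?S) $ a $ b = mat (of_real ((norm \<psi>)\<^sup>2 / CARD('d))) $ a $ b"
      by (cases "a = b")
        (simp_all only: reduction_def density_def mat_def vec_lambda_beta diag offdiag
          sum.neutral_const if_True if_False simp_thms)
  qed
qed

lemma universal_masker_code_matrix: "universal_masker ((*v) (code_matrix w))"
  unfolding universal_masker_def masks_def linear_isometry_def pure_states_def
  by (simp add: matrix_vector_mul_linear_gen norm_code_matrix reduction_code_matrix)

end

text \<open>The type \<open>'d\<close> carries no arithmetic; this makes it a copy of the integers
  modulo \<open>d\<close>.\<close>

lemma ex_residue_labelling: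
  "\<exists>dec :: int \<Rightarrow> 'd::finite. surj dec \<and> (\<forall>m m'. dec m = dec m' \<longleftrightarrow> int CARD('d) dvd m - m')"
proof -
  have "card {0..<int CARD('d)} = CARD('d)"
    by simp
  then obtain e :: "int \<Rightarrow> 'd" where e: "bij_betw e {0..<int CARD('d)} UNIV"
    by (metis finite_same_card_bij finite_atLeastLessThan_int finite)
  let ?dec = "\<lambda>m. e (m mod int CARD('d))"
  have "surj ?dec"
  proof (rule surjI)
    fix x
    have "inv_into {0..<int CARD('d)} e x \<in> {0..<int CARD('d)}"
      using e by (metis UNIV_I bij_betw_def inv_into_into)
    then show "?dec (inv_into {0..<int CARD('d)} e x) = x"
      using e by (simp add: bij_betw_inv_into_right)
  qed
  moreover have "?dec m = ?dec m' \<longleftrightarrow> int CARD('d) dvd m - m'" for m m'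
  proof -
    have "?dec m = ?dec m' \<longleftrightarrow> m mod int CARD('d) = m' mod int CARD('d)"
      using e by (intro inj_on_eq_iff[of e "{0..<int CARD('d)}"]) (auto simp: bij_betw_def)
    then show ?thesis
      by (simp add: mod_eq_dvd_iff)
  qed
  ultimately show ?thesis by blast
qed

text \<open>An affine function on the corners of a square has equal sums along both diagonals, so
  three corners control the fourth. Here \<open>r\<close> is the erased corner.\<close>

lemma dvd_three_corners:
  fixes n D X Y :: int
  assumes "\<And>p q. (p, q) \<noteq> r \<Longrightarrow> n dvd D + of_bool p * X + of_bool q * Y"
  shows "n dvd D \<and> n dvd X \<and> n dvd Y"
proof -
  have FF: "r \<noteq> (False, False) \<Longrightarrow> n dvd D" and TF: "r \<noteq> (True, False) \<Longrightarrow> n dvd D + X"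
    and FT: "r \<noteq> (False, True) \<Longrightarrow> n dvd D + Y" and TT: "r \<noteq> (True, True) \<Longrightarrow> n dvd D + X + Y"
    using assms[of False False] assms[of True False] assms[of False True] assms[of True True]
    by auto
  have D: "n dvd D"
  proof (cases "r = (False, False)")
    case True
    then show ?thesis
      \<comment> \<open>(D + X) + (D + Y) - (D + X + Y) = D.\<close>
      using dvd_diff[OF dvd_add[OF TF FT] TT] by simp
  qed (rule FF)
  have "n dvd X"
  proof (cases "r = (True, False)")
    case True
    then show ?thesis
      using dvd_diff[OF TT FT] by simp
  qed (use TF D in \<open>simp add: dvd_add_right_iff\<close>)
  moreover have "n dvd Y"
  proof (cases "r = (False, True)")
    case True
    then show ?thesis
      using dvd_diff[OF TT TF] by simp
  qed (use FT D in \<open>simp add: dvd_add_right_iff\<close>)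
  ultimately show ?thesis using D by blast
qed

lemma ex_detecting_code:
  assumes "CARD('h::finite) \<le> CARD('d::finite) ^ 2"
  shows "\<exists>w :: 'h \<Rightarrow> 'd \<Rightarrow> 4 \<Rightarrow> 'd. detecting_code w"
proof -
  obtain dec :: "int \<Rightarrow> 'd" where surj: "surj dec"
    and dec_eq: "\<And>m m'. dec m = dec m' \<longleftrightarrow> int CARD('d) dvd m - m'"
    using ex_residue_labelling by blast
  \<comment> \<open>An integer representative for each label; distinct labels get incongruent
    ones.\<close>
  define enc where "enc = inv dec"
  have enc_eqI: "x = y" if "int CARD('d) dvd enc x - enc y" for x y
    using that surj by (metis dec_eq enc_def surj_f_inv_f)
  have "card (UNIV :: 'h set) \<le> card (UNIV :: ('d \<times> 'd) set)"
    using assms by (simp add: power2_eq_square)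
  then obtain g :: "'h \<Rightarrow> 'd \<times> 'd" where "inj g"
    by (metis card_le_inj finite)
  \<comment> \<open>The four tensor factors are indexed by the corners of a square.\<close>
  have "card (UNIV :: 4 set) = card (UNIV :: (bool \<times> bool) set)"
    by simp
  then obtain corner :: "4 \<Rightarrow> bool \<times> bool" where corner: "bij corner"
    by (metis finite finite_same_card_bij)
  \<comment> \<open>With \<open>g k = (x, y)\<close>, the factor at corner \<open>(p, q)\<close>
    carries j + p x + q y modulo \<open>d\<close>.\<close>
  define offset where "offset k i = of_bool (fst (corner i)) * enc (fst (g k))
    + of_bool (snd (corner i)) * enc (snd (g k))" for k i
  define w where "w k j i = dec (enc j + offset k i)" for k j i
  have "detecting_code w"
  proof
    fix l k j k' j'
    assume eq: "\<And>i. i \<noteq> l \<Longrightarrow> w k j i = w k' j' i"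
    have "int CARD('d) dvd enc j - enc j' \<and> int CARD('d) dvd enc (fst (g k)) - enc (fst (g k'))
      \<and> int CARD('d) dvd enc (snd (g k)) - enc (snd (g k'))"
    \<comment> \<open>Agreement off \<open>l\<close> says that the affine function of the
      differences is divisible by \<open>d\<close> at every corner but
      \<open>corner l\<close>.\<close>
    proof (rule dvd_three_corners)
      fix p q
      assume "(p, q) \<noteq> corner l"
      moreover obtain i where i: "corner i = (p, q)"
        using corner by (metis bij_pointE)
      ultimately have "w k j i = w k' j' i"
        using eq by metis
      then show "int CARD('d) dvd enc j - enc j'
          + of_bool p * (enc (fst (g k)) - enc (fst (g k')))
          + of_bool q * (enc (snd (g k)) - enc (snd (g k')))"
        by (simp add: w_def offset_def dec_eq i algebra_simps)
    qed
    then show "k = k' \<and> j = j'"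
      using enc_eqI \<open>inj g\<close> by (metis injD prod_eqI)
  next
    fix k l
    have "inj (\<lambda>j. w k j l)"
      by (auto simp: inj_def w_def dec_eq intro: enc_eqI)
    then show "bij (\<lambda>j. w k j l)"
      by (simp add: bij_def finite_UNIV_inj_surj)
  qed
  then show ?thesis by blast
qed

theorem theorem1:
  assumes "2 \<le> CARD('h::finite)" and "CARD('h) \<le> CARD('d::finite) ^ 2"
  shows "\<exists>S :: complex ^ 'h \<Rightarrow> complex ^ (4 \<Rightarrow> 'd). universal_masker S"
  using ex_detecting_code[OF assms(2)] detecting_code.universal_masker_code_matrix by blast

end
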